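(* Let $n\ge 2$, $v=(4^n-2^n)/2$ and $1\le s<v$. For $\bar S=\{g_{s+1},\ldots,g_v\}\subset\Omega$ a set of $v-s$ (distinct) vectors, let $$F_3 = 3(2^{n})\sum_{u\in\Delta_0}\bar\sigma_u^{2}+\sum_{u\in\Delta}\bar\sigma_u^{3}.$$ Then: (a) The inequality $F_3\le 3(2^{2n+2})(v-s)^2$ holds for every such $\bar S$. (b) Equality holds in (a) if and only if $\bar S$ is even.
   Context: $Z_4=\{0,1,2,3\}$ denotes the integers mod 4; an element of $Z_4$ is even if it is 0 or 2 and odd otherwise. $\Delta=Z_4^n$ is the set of all $n\times 1$ vectors over $Z_4$, and $\Delta_0\subset\Delta$ is the set of the $2^n$ vectors all of whose elements are even. $\Omega\subset\Delta$ is the set of all vectors having at least one odd element and whose first odd element equals 1; it has exactly $v=(4^n-2^n)/2$ elements. With $i=\sqrt{-1}$ and primes denoting transposition, for $u\in\Delta$, $$\bar\sigma_u=\sum_{j=s+1}^{v}\left(i^{u'g_j}+i^{-u'g_j}\right).$$ The set $\bar S=\{g_{s+1},\ldots,g_v\}$ is called even if $g_j+g_k$ has all elements even for every $s+1\le j,k\le v$. *)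

theory Defs
  imports Complex_Main "HOL-Library.FuncSet"
begin

text \<open>
  \<open>Z\<^sub>4\<close> is represented by the integers 0, 1, 2, 3 with arithmetic modulo 4.
  The vector entries are indexed by 0, ..., n-1 (instead of 1, ..., n), and vectors are
  extensional functions, so that equality of vectors is equality of their entries.
\<close>

definition Delta :: "nat \<Rightarrow> (nat \<Rightarrow> int) set" where
  "Delta n = {..<n} \<rightarrow>\<^sub>E {0..3}"

definition Delta0 :: "nat \<Rightarrow> (nat \<Rightarrow> int) set" where
  "Delta0 n = {u \<in> Delta n. \<forall>k<n. even (u k)}"

definition Omega :: "nat \<Rightarrow> (nat \<Rightarrow> int) set" where
  "Omega n = {u \<in> Delta n. \<exists>k<n. odd (u k) \<and> (\<forall>j<k. even (u j)) \<and> u k = 1}"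

definition dot :: "nat \<Rightarrow> (nat \<Rightarrow> int) \<Rightarrow> (nat \<Rightarrow> int) \<Rightarrow> int" where
  "dot n u g = (\<Sum>k<n. u k * g k) mod 4"

definition sigma :: "nat \<Rightarrow> (nat \<Rightarrow> int) set \<Rightarrow> (nat \<Rightarrow> int) \<Rightarrow> complex" where
  "sigma n S u = (\<Sum>g\<in>S. \<i> powi (dot n u g) + \<i> powi (- dot n u g))"

definition even_set :: "nat \<Rightarrow> (nat \<Rightarrow> int) set \<Rightarrow> bool" where
  "even_set n S \<longleftrightarrow> (\<forall>g\<in>S. \<forall>h\<in>S. \<forall>k<n. even ((g k + h k) mod 4))"

definition F3 :: "nat \<Rightarrow> (nat \<Rightarrow> int) set \<Rightarrow> complex" where
  "F3 n S = 3 * 2 ^ n * (\<Sum>u\<in>Delta0 n. (sigma n S u)\<^sup>2) + (\<Sum>u\<in>Delta n. (sigma n S u) ^ 3)"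

end

(* Write the terms of sigma as characters indexed by the signed vectors +-g, g in S, and expand
   the powers of sigma.  By orthogonality of characters F3 = 4^n (3 N2 + N3), where N2 is the number
   of pairs of signed vectors with even sum and N3 the number of triples with sum 0.  In such
   a triple the third vector has an odd entry, so the first two form a pair counted by the complement
   of N2; they also determine the third vector, because distinct signed vectors are incongruent
   mod 4.  Hence N2 + N3 <= (2 |S|)^2, and 3 N2 + N3 <= 3 (2 |S|)^2 with equality exactly when every
   pair has even sum. *)
theory Submission
  imports Defs
begin

lemma powi_i_mod_4: "\<i> powi a = \<i> powi (a mod 4)"
proof -
  have "\<i> powi a = \<i> powi (4 * (a div 4) + a mod 4)" by simp
  also have "\<dots> = \<i> powi (4 * (a div 4)) * \<i> powi (a mod 4)"
    by (rule power_int_add) simp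
  also have "\<i> powi (4 * (a div 4)) = 1" by (simp add: power_int_mult)
  finally show ?thesis by simp
qed

lemma powi_i_sum: "finite A \<Longrightarrow> \<i> powi (\<Sum>k\<in>A. f k) = (\<Prod>k\<in>A. \<i> powi f k)"
  by (induction A rule: finite_induct) (simp_all add: power_int_add)

text \<open>With z = i^a the sum is 1 + z + z^2 + z^3, which vanishes at every fourth root of unity
  other than 1.\<close>

lemma sum_powi_i_Z4: "(\<Sum>x\<in>{0..3::int}. \<i> powi (x * a)) = (if 4 dvd a then 4 else 0)"
proof -
  define z where "z = \<i> powi a"
  have "\<i> powi (x * a) = z powi x" for x
    by (simp add: z_def mult.commute[of x] power_int_mult)
  moreover have "{0..3::int} = {0,1,2,3}" by auto
  ultimately have sum: "(\<Sum>x\<in>{0..3::int}. \<i> powi (x * a)) = 1 + z + z ^ 2 + z ^ 3"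
    by simp
  have z: "z = \<i> powi (a mod 4)" unfolding z_def by (rule powi_i_mod_4)
  consider "a mod 4 = 0" | "a mod 4 = 1" | "a mod 4 = 2" | "a mod 4 = 3" by fastforce
  then show ?thesis
    unfolding sum z by cases (simp_all add: dvd_eq_mod_eq_0 power3_eq_cube)
qed

lemma sum_powi_i_even: "(\<Sum>x\<in>{0,2::int}. \<i> powi (x * a)) = (if even a then 2 else 0)"
proof -
  have "\<i> powi (2 * a) = (-1) powi a" by (simp add: power_int_mult)
  then show ?thesis by (auto simp: power_int_minus_left)
qed

text \<open>The character factors over the coordinates, so the sum over a product set is a product
  of one-coordinate sums. \<open>A\<close> and \<open>P\<close> stay general to serve both
  \<open>Delta\<close> (divisibility by 4) and \<open>Delta0\<close> (evenness).\<close>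

lemma sum_PiE_powi_i:
  assumes "\<And>a. (\<Sum>x\<in>A. \<i> powi (x * a)) = (if P a then c else 0)" and "finite A"
  shows "(\<Sum>u\<in>{..<n} \<rightarrow>\<^sub>E A. \<i> powi (\<Sum>k<n. u k * w k)) = (if \<forall>k<n. P (w k) then c ^ n else 0)"
proof -
  have "(\<Sum>u\<in>{..<n} \<rightarrow>\<^sub>E A. \<i> powi (\<Sum>k<n. u k * w k)) = (\<Prod>k<n. if P (w k) then c else 0)"
    using assms by (simp add: powi_i_sum prod_sum_PiE flip: assms(1))
  then show ?thesis by (auto simp: prod_zero_iff)
qed

lemma Delta0_PiE: "Delta0 n = {..<n} \<rightarrow>\<^sub>E {0,2}"
proof -
  have "even x \<and> x \<in> {0..3} \<longleftrightarrow> x \<in> {0,2}" for x :: int by auto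
  then show ?thesis unfolding Delta0_def Delta_def PiE_iff set_eq_iff mem_Collect_eq lessThan_iff Ball_def by blast
qed

lemma sum_if_card: "finite A \<Longrightarrow> (\<Sum>x\<in>A. if P x then c else 0) = of_nat (card {x\<in>A. P x}) * (c::complex)"
  by (simp flip: sum.inter_filter)

text \<open>The sign is a separate component, so each g contributes two terms without any check that
  g and -g differ.\<close>

definition signed :: "(nat \<Rightarrow> int) set \<Rightarrow> ((nat \<Rightarrow> int) \<times> int) set" where
  "signed S = S \<times> {1,-1}"

definition entry :: "(nat \<Rightarrow> int) \<times> int \<Rightarrow> nat \<Rightarrow> int" where
  "entry p k = snd p * fst p k"

lemma sigma_signed:
  assumes "finite S"
  shows "sigma n S u = (\<Sum>p\<in>signed S. \<i> powi (\<Sum>k<n. u k * entry p k))"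
proof -
  have pos: "\<i> powi dot n u g = \<i> powi (\<Sum>k<n. u k * g k)" for g
    unfolding dot_def using powi_i_mod_4 by metis
  have neg: "\<i> powi (- dot n u g) = \<i> powi (\<Sum>k<n. u k * - g k)" for g
    by (simp add: pos power_int_minus sum_negf)
  have "(\<Sum>p\<in>signed S. \<i> powi (\<Sum>k<n. u k * entry p k)) =
      (\<Sum>g\<in>S. \<Sum>e\<in>{1,-1}. \<i> powi (\<Sum>k<n. u k * (e * g k)))"
    unfolding signed_def entry_def by (simp only: sum.cartesian_product case_prod_unfold)
  then show ?thesis unfolding sigma_def pos neg by simp
qed

definition even_pairs :: "nat \<Rightarrow> (nat \<Rightarrow> int) set \<Rightarrow> (((nat \<Rightarrow> int) \<times> int) \<times> ((nat \<Rightarrow> int) \<times> int)) set" where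
  "even_pairs n S = {x \<in> signed S \<times> signed S. \<forall>k<n. even (entry (fst x) k + entry (snd x) k)}"

text \<open>Nested so that \<open>fst\<close> yields the pair to be compared with
  \<open>even_pairs\<close>.\<close>

definition zero_triples ::
    "nat \<Rightarrow> (nat \<Rightarrow> int) set \<Rightarrow> ((((nat \<Rightarrow> int) \<times> int) \<times> ((nat \<Rightarrow> int) \<times> int)) \<times> ((nat \<Rightarrow> int) \<times> int)) set" where
  "zero_triples n S = {x \<in> (signed S \<times> signed S) \<times> signed S.
     \<forall>k<n. 4 dvd entry (fst (fst x)) k + entry (snd (fst x)) k + entry (snd x) k}"

lemma finite_signed: "finite S \<Longrightarrow> finite (signed S)"
  by (simp add: signed_def)

lemma card_signed: "card (signed S) = 2 * card S"
  by (simp add: signed_def card_cartesian_product)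

text \<open>The square is a sum of characters over pairs; after exchanging the sums, orthogonality
  over \<open>Delta0\<close> leaves 2^n for each pair with even sum.\<close>

lemma sum_sigma_square:
  assumes "finite S"
  shows "(\<Sum>u\<in>Delta0 n. (sigma n S u)\<^sup>2) = of_nat (card (even_pairs n S)) * 2 ^ n"
proof -
  let ?T = "signed S"
  have sq: "(sigma n S u)\<^sup>2 =
      (\<Sum>x\<in>?T \<times> ?T. \<i> powi (\<Sum>k<n. u k * (entry (fst x) k + entry (snd x) k)))" for u
    by (simp add: sigma_signed[OF assms] power2_eq_square sum_product sum.cartesian_product
        case_prod_unfold distrib_left sum.distrib power_int_add)
  show ?thesis
    unfolding sq Delta0_PiE even_pairs_def
    by (subst sum.swap) (simp only: sum_PiE_powi_i[OF sum_powi_i_even] finite.intros,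
        simp add: sum_if_card finite_signed assms)
qed

lemma sum_sigma_cube:
  assumes "finite S"
  shows "(\<Sum>u\<in>Delta n. (sigma n S u) ^ 3) = of_nat (card (zero_triples n S)) * 4 ^ n"
proof -
  let ?T = "signed S"
  have cube: "(sigma n S u) ^ 3 = (\<Sum>x\<in>(?T \<times> ?T) \<times> ?T.
      \<i> powi (\<Sum>k<n. u k * (entry (fst (fst x)) k + entry (snd (fst x)) k + entry (snd x) k)))" for u
    by (simp add: sigma_signed[OF assms] power3_eq_cube sum_product sum.cartesian_product
        case_prod_unfold distrib_left sum.distrib power_int_add)
  show ?thesis
    unfolding cube Delta_def zero_triples_def
    by (subst sum.swap) (simp only: sum_PiE_powi_i[OF sum_powi_i_Z4] finite_atLeastAtMost_int,
        simp add: sum_if_card finite_signed assms)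
qed

lemma F3_eq_counts:
  assumes "finite S"
  shows "F3 n S = of_nat (4 ^ n * (3 * card (even_pairs n S) + card (zero_triples n S)))"
proof -
  have "(4::complex) ^ n = 2 ^ n * 2 ^ n" by (simp flip: power_mult_distrib)
  then show ?thesis
    unfolding F3_def sum_sigma_square[OF assms] sum_sigma_cube[OF assms]
    by (simp add: algebra_simps)
qed

text \<open>Signs and congruence mod 4 preserve parity, so the first odd positions coincide. Both
  entries there are 1, which forces equal signs; the remaining entries are then congruent and lie in
  0..3.\<close>

lemma Omega_cong_signed:
  assumes g: "g \<in> Omega n" and h: "h \<in> Omega n" and e: "e \<in> {1,-1}" "f \<in> {1,-1}"
    and c: "\<And>k. k < n \<Longrightarrow> 4 dvd e * g k - f * h k"
  shows "g = h \<and> e = f"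
proof -
  obtain a where a: "a < n" "g a = 1" "\<forall>j<a. even (g j)" using g by (auto simp: Omega_def)
  obtain b where b: "b < n" "h b = 1" "\<forall>j<b. even (h j)" using h by (auto simp: Omega_def)
  have par: "even (g k) \<longleftrightarrow> even (h k)" if "k < n" for k
  proof -
    have "even (e * g k - f * h k)" using c[OF that] by presburger
    then show ?thesis using e by auto
  qed
  have "a = b" using a b par by (metis linorder_neqE_nat odd_one)
  \<comment> \<open>At the common position the hypothesis reads 4 dvd e - f, while e - f is -2, 0 or
    2.\<close>
  then have ef: "e = f" using c[OF a(1)] a b e by auto
  have "g k = h k" if "k < n" for k
  proof -
    have "g k \<in> {0..3}" "h k \<in> {0..3}"
      using g h that by (auto simp: Omega_def Delta_def PiE_iff)
    moreover have "4 dvd g k - h k" using c[OF that] e ef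
      by (auto simp: dvd_diff_commute)
    ultimately show ?thesis unfolding atLeastAtMost_iff by presburger
  qed
  \<comment> \<open>Beyond the first n indices both functions are \<open>undefined\<close>.\<close>
  moreover have "g \<in> extensional {..<n}" "h \<in> extensional {..<n}"
    using g h by (auto simp: Omega_def Delta_def PiE_iff)
  ultimately have "g = h" by (intro extensionalityI[of g "{..<n}" h]) simp_all
  then show ?thesis using ef by simp
qed

lemma zero_triples_snd:
  assumes "S \<subseteq> Omega n" "x \<in> zero_triples n S"
  shows "fst (snd x) \<in> Omega n" "snd (snd x) \<in> {1,-1}"
proof -
  have "snd x \<in> S \<times> {1,-1}"
    using assms(2) unfolding zero_triples_def signed_def mem_Collect_eq mem_Times_iff[of x] by blast
  then show "fst (snd x) \<in> Omega n" "snd (snd x) \<in> {1,-1}"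
    using assms(1) by (auto simp only: mem_Times_iff)
qed

lemma inj_on_zero_triples:
  assumes "S \<subseteq> Omega n"
  shows "inj_on fst (zero_triples n S)"
proof (rule inj_onI)
  fix x y assume x: "x \<in> zero_triples n S" and y: "y \<in> zero_triples n S" and xy: "fst x = fst y"
  have mem: "fst (snd x) \<in> Omega n" "fst (snd y) \<in> Omega n"
      "snd (snd x) \<in> {1,-1}" "snd (snd y) \<in> {1,-1}"
    using zero_triples_snd[OF assms] x y by auto
  have "4 dvd snd (snd x) * fst (snd x) k - snd (snd y) * fst (snd y) k" if "k < n" for k
  proof -
    have "4 dvd entry (fst (fst x)) k + entry (snd (fst x)) k + entry (snd x) k"
      "4 dvd entry (fst (fst x)) k + entry (snd (fst x)) k + entry (snd y) k"
      using x y that unfolding zero_triples_def mem_Collect_eq xy by blast+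
    \<comment> \<open>The common pair cancels in the difference.\<close>
    from dvd_diff[OF this] show ?thesis by (simp add: entry_def)
  qed
  from Omega_cong_signed[OF mem this]
  have "fst (snd x) = fst (snd y) \<and> snd (snd x) = snd (snd y)" .
  then show "x = y" using xy by (simp add: prod_eq_iff)
qed

text \<open>Where the third vector has an odd entry, the sum of the first two must be odd as
  well.\<close>

lemma fst_zero_triples:
  assumes "S \<subseteq> Omega n"
  shows "fst ` zero_triples n S \<subseteq> signed S \<times> signed S - even_pairs n S"
proof (rule image_subsetI)
  fix x assume x: "x \<in> zero_triples n S"
  then have mem: "fst x \<in> signed S \<times> signed S"
    and dvd: "\<forall>k<n. 4 dvd entry (fst (fst x)) k + entry (snd (fst x)) k + entry (snd x) k"
    unfolding zero_triples_def mem_Collect_eq mem_Times_iff[of x] by blast+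
  obtain k where k: "k < n" "odd (fst (snd x) k)"
    using zero_triples_snd(1)[OF assms x] unfolding Omega_def by blast
  have "odd (entry (snd x) k)"
    using k zero_triples_snd(2)[OF assms x] by (auto simp: entry_def)
  with dvd[rule_format, OF k(1)] have "odd (entry (fst (fst x)) k + entry (snd (fst x)) k)"
    by presburger
  then show "fst x \<in> signed S \<times> signed S - even_pairs n S"
    using mem k(1) unfolding even_pairs_def by blast
qed

lemma card_even_pairs_zero_triples:
  assumes "S \<subseteq> Omega n" "finite S"
  shows "card (even_pairs n S) + card (zero_triples n S) \<le> 4 * (card S)\<^sup>2"
proof -
  let ?P = "signed S \<times> signed S"
  have fin: "finite ?P" using finite_signed assms by simp
  have sub: "even_pairs n S \<subseteq> ?P" by (auto simp: even_pairs_def)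
  have "card (zero_triples n S) \<le> card (?P - even_pairs n S)"
    using card_inj_on_le[OF inj_on_zero_triples fst_zero_triples] assms fin by blast
  also have "\<dots> = card ?P - card (even_pairs n S)"
    using card_Diff_subset[OF finite_subset[OF sub fin] sub] .
  finally show ?thesis
    using card_mono[OF fin sub] by (simp add: card_cartesian_product card_signed power2_eq_square)
qed

text \<open>A sign does not change parity, so evenness of S means that \<open>even_pairs\<close> is
  the whole finite set of pairs, which its cardinality detects.\<close>

lemma even_set_iff_card:
  assumes "finite S"
  shows "even_set n S \<longleftrightarrow> card (even_pairs n S) = 4 * (card S)\<^sup>2"
proof -
  let ?P = "signed S \<times> signed S"
  have fin: "finite ?P" using finite_signed assms by simp
  have sub: "even_pairs n S \<subseteq> ?P" by (auto simp: even_pairs_def)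
  have mod4: "even (x mod 4) \<longleftrightarrow> even x" for x :: int by presburger
  have parity: "even (entry p k + entry q k) \<longleftrightarrow> even (fst p k + fst q k)"
    if "p \<in> signed S" "q \<in> signed S" for p q k
    using that by (auto simp: signed_def entry_def)
  have "even_set n S \<longleftrightarrow> (\<forall>p\<in>signed S. \<forall>q\<in>signed S. \<forall>k<n. even (fst p k + fst q k))"
    unfolding even_set_def mod4 signed_def by auto
  also have "\<dots> \<longleftrightarrow> (\<forall>p\<in>signed S. \<forall>q\<in>signed S. \<forall>k<n. even (entry p k + entry q k))"
    by (simp only: parity cong: ball_cong)
  also have "\<dots> \<longleftrightarrow> even_pairs n S = ?P"
    unfolding even_pairs_def by fastforce
  also have "\<dots> \<longleftrightarrow> card (even_pairs n S) = card ?P"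
    using card_subset_eq[OF fin sub] by auto
  finally show ?thesis by (simp add: card_cartesian_product card_signed power2_eq_square)
qed

text \<open>\<open>F3\<close> is complex-valued, so the inequality is expressed as realness together
  with a bound on the real part.\<close>

theorem theorem1:
  fixes n v s :: nat and S :: "(nat \<Rightarrow> int) set"
  assumes "n \<ge> 2"
    and "v = (4 ^ n - 2 ^ n) div 2"
    and "1 \<le> s" and "s < v"
    and "S \<subseteq> Omega n" and "card S = v - s"
  shows "(F3 n S \<in> \<real> \<and> Re (F3 n S) \<le> 3 * 2 ^ (2 * n + 2) * (real (v - s))\<^sup>2) \<and>
    (F3 n S = 3 * 2 ^ (2 * n + 2) * (of_nat (v - s))\<^sup>2 \<longleftrightarrow> even_set n S)"
proof -
  define m A B where "m = v - s" and "A = card (even_pairs n S)" and "B = card (zero_triples n S)"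
  \<comment> \<open>The cardinality v - s is positive, whereas an infinite set has
    \<open>card\<close> 0.\<close>
  have fin: "finite S" using assms by (intro card_ge_0_finite) simp
  have F: "F3 n S = of_nat (4 ^ n * (3 * A + B))" unfolding A_def B_def by (rule F3_eq_counts[OF fin])
  have le: "A + B \<le> 4 * m\<^sup>2"
    using card_even_pairs_zero_triples[OF assms(5) fin] assms(6) by (simp add: A_def B_def m_def)
  have ev: "even_set n S \<longleftrightarrow> A = 4 * m\<^sup>2"
    using even_set_iff_card[OF fin] assms(6) by (simp add: A_def m_def)
  \<comment> \<open>The bound as a natural number, with 12 m^2 = 3 (2m)^2, so that all comparisons
    take place in \<open>nat\<close>.\<close>
  define N where "N = 4 ^ n * (12 * m\<^sup>2)"
  have pow: "(2::'a::comm_semiring_1) ^ (2 * n + 2) = 4 ^ n * 4"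
    using power_mult[of "2::'a" 2 n] by (simp add: mult.commute)
  have bound_real: "3 * 2 ^ (2 * n + 2) * (real (v - s))\<^sup>2 = real N"
    and bound_complex: "3 * 2 ^ (2 * n + 2) * (of_nat (v - s))\<^sup>2 = (of_nat N :: complex)"
    unfolding N_def pow m_def[symmetric] by simp_all
  \<comment> \<open>Here 3A + B \<le> 3(A + B) \<le> 12 m^2.\<close>
  have "4 ^ n * (3 * A + B) \<le> N" unfolding N_def using le by (intro mult_left_mono) auto
  then have "Re (F3 n S) \<le> real N" unfolding F by (simp only: complex_Re_of_nat of_nat_le_iff)
  moreover have "F3 n S = of_nat N \<longleftrightarrow> 3 * A + B = 12 * m\<^sup>2"
    unfolding F N_def of_nat_eq_iff by simp
  \<comment> \<open>Since 3A + B = 2A + (A + B) \<le> 2A + 4 m^2, equality forces A = 4 m^2;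
    conversely A = 4 m^2 forces B = 0.\<close>
  moreover have "\<dots> \<longleftrightarrow> even_set n S" unfolding ev using le by auto
  moreover have "F3 n S \<in> \<real>" unfolding F by (rule Reals_of_nat)
  ultimately show ?thesis unfolding bound_real bound_complex by simp
qed

end
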